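(* Let $t_0\in\mathbb{R}$, let $p,q:[t_0,+\infty)\to\mathbb{C}$ be continuous functions, and consider the equation $$\phi''(t)+p(t)\phi'(t)+q(t)\phi(t)=0,\qquad t\ge t_0. \quad ( * )$$ Assume that $p$ is continuously differentiable, that $D(t):=2p'(t)+p(t)^2-4q(t)$ is real with $D(t)>0$ for all $t\ge t_0$, and that $D$ is continuously differentiable on $[t_0,+\infty)$. Assume moreover that at least one of the following two groups of conditions holds: (C) there is $\varepsilon>0$ with $D(t)\ge\varepsilon$ for all $t\ge t_0$, the function $\dfrac{D'(t)}{D(t)}$ is bounded on $[t_0,+\infty)$, and $\displaystyle\int_{t_0}^{+\infty}\rho_{D/4}(s)\,\frac{|D'(s)|}{D(s)^{3/2}}\,ds<+\infty$; (D) $D$ is nondecreasing on $[t_0,+\infty)$ and $\dfrac{D'(t)}{D(t)}$ is bounded on $[t_0,+\infty)$. Let $$r_2(t):=\int_{t_0}^t\bigl[\sqrt{D(\tau)}-\operatorname{Re}p(\tau)\bigr]d\tau-\tfrac12\ln D(t)+2\ln\bigl[1+|p(t)-\sqrt{D(t)}|\bigr],\qquad t\ge t_0.$$ Then: (i) equation $( * )$ is Liapunov stable if and only if $r_2$ is bounded from above on $[t_0,+\infty)$; (ii) equation $( * )$ is asymptotically stable if and only if $\lim_{t\to+\infty}r_2(t)=-\infty$.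
   Context: For a positive continuously differentiable function $x$ on $[t_0,+\infty)$ and $t_0\le t_1\le t$, define $$R_x(t_1;t):=\frac{1+\sqrt{x(t_0)}(t_1-t_0)}{1+\sqrt{x(t_0)}(t-t_0)}\exp\Bigl\{-\int_{t_1}^t\sqrt{x(s)}\,ds\Bigr\}\sup_{\xi\in[t_0,t_1]}\frac{|(\sqrt{x(\xi)})'|}{\sqrt{x(\xi)}}+\sup_{\xi\in[t_1,t]}\frac{|(\sqrt{x(\xi)})'|}{\sqrt{x(\xi)}},$$ $$\rho_x(t):=\inf_{t_1\in[t_0,t]}R_x(t_1;t),\qquad t\ge t_0.$$ The function $\rho_{D/4}$ is $\rho_x$ for $x=D/4$. The second order equation is called Liapunov stable (respectively asymptotically stable) if the zero solution of the equivalent linear first order system $\phi'=\psi$, $\psi'=-q(t)\phi-p(t)\psi$ (with complex-valued solutions $(\phi,\psi)=(\phi,\phi')$ on $[t_0,+\infty)$) is Liapunov stable (respectively asymptotically stable) as $t\to+\infty$. *)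

theory Defs
  imports "HOL-Analysis.Analysis"
begin

text \<open>All functions live on the half-line \<open>{t\<^sub>0..}\<close>; they are total in HOL, but only their
  values on \<open>{t\<^sub>0..}\<close> matter, and derivatives are taken within \<open>{t\<^sub>0..}\<close>
  (so one-sided at the endpoint \<open>t\<^sub>0\<close>).\<close>

definition sqrt_logderiv :: "real \<Rightarrow> (real \<Rightarrow> real) \<Rightarrow> real \<Rightarrow> real" where
  "sqrt_logderiv t0 x \<xi> =
     \<bar>vector_derivative (\<lambda>s. sqrt (x s)) (at \<xi> within {t0..})\<bar> / sqrt (x \<xi>)"

text \<open>For positive \<open>C\<^sup>1\<close> functions \<open>x\<close>, both suprema below are suprema of nonempty sets that are
  bounded above, so the real-valued \<open>SUP\<close> is the genuine one. Likewise the infimum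
  defining \<open>\<rho>\<close> is over a nonempty set of nonnegative reals.\<close>

definition R :: "real \<Rightarrow> (real \<Rightarrow> real) \<Rightarrow> real \<Rightarrow> real \<Rightarrow> real" where
  "R t0 x t1 t =
     (1 + sqrt (x t0) * (t1 - t0)) / (1 + sqrt (x t0) * (t - t0))
       * exp (- integral {t1..t} (\<lambda>s. sqrt (x s)))
       * (SUP \<xi>\<in>{t0..t1}. sqrt_logderiv t0 x \<xi>)
     + (SUP \<xi>\<in>{t1..t}. sqrt_logderiv t0 x \<xi>)"

definition \<rho> :: "real \<Rightarrow> (real \<Rightarrow> real) \<Rightarrow> real \<Rightarrow> real" where
  "\<rho> t0 x t = (INF t1\<in>{t0..t}. R t0 x t1 t)"

definition solves_system ::
  "real \<Rightarrow> (real \<Rightarrow> complex) \<Rightarrow> (real \<Rightarrow> complex) \<Rightarrow> (real \<Rightarrow> complex \<times> complex) \<Rightarrow> bool" where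
  "solves_system t0 p q y \<longleftrightarrow>
     (\<forall>t\<ge>t0. (y has_vector_derivative
        (snd (y t), - q t * fst (y t) - p t * snd (y t))) (at t within {t0..}))"

text \<open>Stability of the zero solution, with initial data prescribed at \<open>t\<^sub>0\<close>. The norm on pairs is
  the Euclidean one. As the system is linear with continuous coefficients, every
  initial value has a solution on the whole of \<open>{t\<^sub>0..}\<close>, so quantifying over global
  solutions loses nothing.\<close>

definition liapunov_stable :: "real \<Rightarrow> (real \<Rightarrow> complex) \<Rightarrow> (real \<Rightarrow> complex) \<Rightarrow> bool" where
  "liapunov_stable t0 p q \<longleftrightarrow>
     (\<forall>\<epsilon>>0. \<exists>\<delta>>0. \<forall>y. solves_system t0 p q y \<longrightarrow> norm (y t0) < \<delta> \<longrightarrow>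
        (\<forall>t\<ge>t0. norm (y t) < \<epsilon>))"

definition asymptotically_stable :: "real \<Rightarrow> (real \<Rightarrow> complex) \<Rightarrow> (real \<Rightarrow> complex) \<Rightarrow> bool" where
  "asymptotically_stable t0 p q \<longleftrightarrow>
     liapunov_stable t0 p q \<and>
     (\<exists>\<delta>>0. \<forall>y. solves_system t0 p q y \<longrightarrow> norm (y t0) < \<delta> \<longrightarrow> (y \<longlongrightarrow> 0) at_top)"

definition r2 :: "real \<Rightarrow> (real \<Rightarrow> complex) \<Rightarrow> (real \<Rightarrow> real) \<Rightarrow> real \<Rightarrow> real" where
  "r2 t0 p D t =
     integral {t0..t} (\<lambda>\<tau>. sqrt (D \<tau>) - Re (p \<tau>)) - 1/2 * ln (D t)
       + 2 * ln (1 + cmod (p t - complex_of_real (sqrt (D t))))"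

text \<open>In (C), the integrand is nonnegative, so finiteness of the improper integral
  is the same as integrability on \<open>{t\<^sub>0..}\<close>.\<close>

definition condition_C :: "real \<Rightarrow> (real \<Rightarrow> real) \<Rightarrow> (real \<Rightarrow> real) \<Rightarrow> bool" where
  "condition_C t0 D D' \<longleftrightarrow>
     (\<exists>\<epsilon>>0. \<forall>t\<ge>t0. D t \<ge> \<epsilon>) \<and>
     bounded ((\<lambda>t. D' t / D t) ` {t0..}) \<and>
     (\<lambda>s. \<rho> t0 (\<lambda>t. D t / 4) s * (\<bar>D' s\<bar> / D s powr (3/2))) integrable_on {t0..}"

definition condition_D :: "real \<Rightarrow> (real \<Rightarrow> real) \<Rightarrow> (real \<Rightarrow> real) \<Rightarrow> bool" where
  "condition_D t0 D D' \<longleftrightarrow>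
     mono_on {t0..} D \<and> bounded ((\<lambda>t. D' t / D t) ` {t0..})"

end

theory Submission
  imports Defs
begin

text \<open>The substitution $\phi = e^{-\frac12\int p}\,u$ turns the equation into $u'' = a^2 u$ with
  $a = \frac12\sqrt D > 0$, so everything rests on the growth of one real solution of the
  undamped equation. Take the solution $u$ with $u(t_0) = 1$, $u'(t_0) = a(t_0)$, which is
  positive and convex, and let $z = u'/u - a$ measure how far its logarithmic derivative is from
  $a$. Then $z(t_0) = 0$.

  The function $z$ is small: $(u' - au)\,e^{\int a}$ has derivative $-a'\,u\,e^{\int a}$, and if
  $|a'| \le S a$ this is at most $S$ times the derivative of $u\,e^{\int a}$. Integrating from $t_1$
  to $t$ and dividing by $u\,e^{\int a}$ gives
  $|z(t)| \le |z(t_1)|\,\frac{u(t_1)}{u(t)}\,e^{-\int_{t_1}^t a} + S$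
  (\<open>z_propagation\<close>). With $t_1 = t_0$ this bounds $z$ by the supremum of $|a'|/a$. Since moreover
  $u(t)/(1 + a(t_0)(t - t_0))$ is nondecreasing, a general $t_1$ gives $|z(t)| \le R(t_1;t)$, hence
  $|z| \le \rho$ (\<open>z_le_\<rho>\<close>): the definition of $\rho$ is shaped by this argument.

  The function $H = \ln(u' + au) - \int a - \frac12\ln a$ has
  $H' = -a'z/(2a(u'/u + a))$, so $|H'| \le |a'||z|/(2a^2)$. Under (C) this is dominated by the
  integrable function $\frac12\rho\,|D'|/D^{3/2}$; under (D) it is at most a constant times the
  derivative of the bounded function $-1/a$. In both cases $H$ is bounded, and as $u'/(au)$
  is bounded too, $\ln u = \int a - \frac12\ln a + O(1)$ (\<open>log_u_asymptotics\<close>). This is the WKB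
  asymptotics of $u$.

  Any other solution of $u'' = a^2u$ is dominated by $u$, because the Wronskian is constant and
  $1/u^2$ is integrable (\<open>solution_dominated\<close>). Translated back, the pair $(\phi,\phi')$ belonging
  to $u$ has norm comparable to $|e^{-\frac12\int p}|\,u\,(1 + |p - 2a|)$, that is, to $e^{r_2/2}$ up
  to constant factors, and every solution is bounded by a constant times its initial norm times
  $e^{r_2/2}$. Both claims follow from these two bounds (\<open>stability_iff_growth_exponent\<close>).\<close>

section \<open>Calculus on a closed half-line\<close>

lemma has_vector_derivative_Ici_at:
  assumes "(f has_vector_derivative d) (at t within {t0..})" "t0 < (t::real)"
  shows "(f has_vector_derivative d) (at t)"
proof -
  have "at t within {t0..} = at t"
    using assms(2) by (intro at_within_interior) (simp add: interior_real_atLeast)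
  then show ?thesis using assms(1) by simp
qed

lemma at_within_Ici_eq_Icc: "at t within {t0..} = at t within {t0..t + 1}" for t0 t :: real
  by (rule at_within_nhd[where S = "{..<t + 1}"]) auto

lemma at_within_Ici_neq_bot:
  assumes "t0 \<le> (t::real)"
  shows "at t within {t0..} \<noteq> bot"
proof -
  have "at_right t \<le> at t within {t0..}" using assms by (intro at_le) auto
  then show ?thesis using trivial_limit_at_right_real[of t] by (metis bot.extremum_uniqueI)
qed

text \<open>The mean value inequality for one-sided derivatives; with a scalar majorant \<open>\<phi>\<close> it replaces
  integration of the estimate \<open>norm (f' t) \<le> \<phi>' t\<close>, so that no integrals have to be computed.\<close>

lemma Ici_norm_diff_le:
  fixes f :: "real \<Rightarrow> 'a::real_normed_vector"
  assumes "t0 \<le> a" "a \<le> b"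
    and f: "\<And>t. t \<in> {a..b} \<Longrightarrow> (f has_vector_derivative f' t) (at t within {t0..})"
    and \<phi>: "\<And>t. t \<in> {a..b} \<Longrightarrow> (\<phi> has_real_derivative \<phi>' t) (at t within {t0..})"
    and le: "\<And>t. t \<in> {a..b} \<Longrightarrow> norm (f' t) \<le> \<phi>' t"
  shows "norm (f b - f a) \<le> \<phi> b - \<phi> a"
proof (cases "a = b")
  case False
  have sub: "{a..b} \<subseteq> {t0..}" using assms by auto
  show ?thesis
  proof (rule differentiable_bound_general[where f' = f' and \<phi>' = \<phi>'])
    show "continuous_on {a..b} f"
      using f sub by (meson continuous_on_eq_continuous_within continuous_within_subset
          has_vector_derivative_continuous)
    show "continuous_on {a..b} \<phi>"
      using \<phi> sub by (meson continuous_on_eq_continuous_within continuous_within_subset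
          DERIV_continuous)
  next
    fix x assume x: "a < x" "x < b"
    then have x': "x \<in> {a..b}" "t0 < x" using assms by auto
    show "(f has_vector_derivative f' x) (at x)"
      using has_vector_derivative_Ici_at[OF f] x' by blast
    show "(\<phi> has_vector_derivative \<phi>' x) (at x)"
      using has_vector_derivative_Ici_at[OF \<phi>[unfolded has_real_derivative_iff_has_vector_derivative]] x' by blast
    show "norm (f' x) \<le> \<phi>' x" using le x' by blast
  qed (use False assms in auto)
qed simp

lemma Ici_mono:
  fixes \<phi> :: "real \<Rightarrow> real"
  assumes "t0 \<le> a" "a \<le> b"
    and "\<And>t. t \<in> {a..b} \<Longrightarrow> (\<phi> has_real_derivative \<phi>' t) (at t within {t0..})"
    and "\<And>t. t \<in> {a..b} \<Longrightarrow> 0 \<le> \<phi>' t"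
  shows "\<phi> a \<le> \<phi> b"
  using Ici_norm_diff_le[of t0 a b "\<lambda>_. 0::real" "\<lambda>_. 0" \<phi> \<phi>'] assms by simp

lemma Ici_constant:
  fixes f :: "real \<Rightarrow> 'a::real_normed_vector"
  assumes "t0 \<le> t"
    and "\<And>s. t0 \<le> s \<Longrightarrow> (f has_vector_derivative 0) (at s within {t0..})"
  shows "f t = f t0"
  using Ici_norm_diff_le[of t0 t0 t f "\<lambda>_. 0" "\<lambda>_. 0" "\<lambda>_. 0"] assms by simp

lemma Ici_integral_has_vector_derivative:
  fixes f :: "real \<Rightarrow> 'a::banach"
  assumes "continuous_on {t0..} f" "t0 \<le> t"
  shows "((\<lambda>t. integral {t0..t} f) has_vector_derivative f t) (at t within {t0..})"
  unfolding at_within_Ici_eq_Icc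
  by (rule integral_has_vector_derivative) (use assms in \<open>auto intro: continuous_on_subset\<close>)

text \<open>The endpoint \<open>t0\<close> is included: every difference quotient within the half-line is nonnegative.\<close>

lemma Ici_deriv_nonneg:
  fixes f :: "real \<Rightarrow> real"
  assumes "mono_on {t0..} f" "(f has_real_derivative d) (at t within {t0..})" "t0 \<le> t"
  shows "0 \<le> d"
proof (rule tendsto_lowerbound)
  show "((\<lambda>y. (f y - f t) / (y - t)) \<longlongrightarrow> d) (at t within {t0..})"
    using assms(2) by (simp add: has_field_derivative_iff)
  have "0 \<le> (f y - f t) / (y - t)" if "t0 \<le> y" for y
    using mono_onD[OF assms(1), of y t] mono_onD[OF assms(1), of t y] that assms(3)
    by (cases "y \<le> t") (auto intro: divide_nonpos_nonpos)
  then show "\<forall>\<^sub>F y in at t within {t0..}. 0 \<le> (f y - f t) / (y - t)"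
    by (auto simp: eventually_at_filter)
  show "at t within {t0..} \<noteq> bot" by (rule at_within_Ici_neq_bot[OF assms(3)])
qed

section \<open>Existence for linear differential equations\<close>

text \<open>The Picard iterates with initial function \<open>y0\<close> are summed as a series. Its \<open>n\<close>-th term is at most
  \<open>norm y0 * (K * (t - t0)) ^ n / fact n\<close> on \<open>{t0..T}\<close>, where \<open>K\<close> bounds \<open>norm (A s)\<close> there, so the
  series converges uniformly on compact intervals and may be integrated termwise. Linearity makes the
  solution global at once, without a continuation argument.\<close>

lemma linear_ode_solution_exists:
  fixes A :: "real \<Rightarrow> 'a::banach \<Rightarrow>\<^sub>L 'a"
  assumes A: "continuous_on {t0..} A"
  obtains y where "y t0 = y0"
    and "\<And>t. t0 \<le> t \<Longrightarrow> (y has_vector_derivative A t (y t)) (at t within {t0..})"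
proof -
  define w where "w = rec_nat (\<lambda>_::real. y0) (\<lambda>_ f t. integral {t0..t} (\<lambda>s. A s (f s)))"
  have w0: "w 0 t = y0" and wS: "w (Suc n) t = integral {t0..t} (\<lambda>s. A s (w n s))" for n t
    by (simp_all add: w_def)
  have wcont: "continuous_on {t0..} (w n)" for n
  proof (induction n)
    case 0
    show ?case by (simp add: w_def)
  next
    case (Suc n)
    have "continuous_on {t0..} (\<lambda>s. A s (w n s))"
      using A Suc by (intro continuous_intros)
    from Ici_integral_has_vector_derivative[OF this] show ?case
      unfolding continuous_on_eq_continuous_within wS[abs_def]
      by (auto intro: has_vector_derivative_continuous)
  qed
  have Awcont: "continuous_on {t0..} (\<lambda>s. A s (w n s))" for n
    using A wcont by (intro continuous_intros)
  have wderiv: "(w (Suc n) has_vector_derivative A t (w n t)) (at t within {t0..})"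
    if "t0 \<le> t" for n t
    using Ici_integral_has_vector_derivative[OF Awcont that] unfolding wS[abs_def] .
  define y where "y t = (\<Sum>n. w n t)" for t
  have key: "continuous_on {t0..T} y \<and> (\<forall>t\<in>{t0..T}. y t = y0 + integral {t0..t} (\<lambda>s. A s (y s)))"
    if T: "t0 \<le> T" for T
  proof -
    have "compact (A ` {t0..T})"
      by (intro compact_continuous_image continuous_on_subset[OF A]) auto
    then obtain K where K: "K \<ge> 0" "\<And>s. s \<in> {t0..T} \<Longrightarrow> norm (A s) \<le> K"
      by (auto dest!: compact_imp_bounded simp: bounded_pos) (meson less_imp_le atLeastAtMost_iff)
    have bound: "norm (w n t) \<le> norm y0 * ((K * (t - t0)) ^ n / fact n)" if "t \<in> {t0..T}" for n t
      using that
    proof (induction n arbitrary: t)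
      case (Suc n)
      let ?\<phi> = "\<lambda>t. norm y0 * ((K * (t - t0)) ^ Suc n / fact (Suc n))"
      have "norm (w (Suc n) t - w (Suc n) t0) \<le> ?\<phi> t - ?\<phi> t0"
      proof (rule Ici_norm_diff_le[of t0 t0 t, OF _ _ wderiv])
        fix s assume s: "s \<in> {t0..t}"
        have "fact (Suc n) = real (Suc n) * fact n" by simp
        then show "(?\<phi> has_real_derivative K * (norm y0 * ((K * (s - t0)) ^ n / fact n)))
            (at s within {t0..})"
          by (auto intro!: derivative_eq_intros simp del: fact_Suc power_Suc)
        have "norm (A s (w n s)) \<le> norm (A s) * norm (w n s)" by (rule norm_blinfun)
        also have "\<dots> \<le> K * (norm y0 * ((K * (s - t0)) ^ n / fact n))"
          using s Suc.prems by (intro mult_mono K Suc.IH) (use K in auto)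
        finally show "norm (A s (w n s)) \<le> K * (norm y0 * ((K * (s - t0)) ^ n / fact n))" .
      qed (use Suc.prems in auto)
      then show ?case by (simp add: wS)
    qed (simp add: w0)
    define M where "M n = norm y0 * ((K * (T - t0)) ^ n / fact n)" for n
    have wM: "norm (w n t) \<le> M n" if "t \<in> {t0..T}" for n t
    proof -
      have "norm (w n t) \<le> norm y0 * ((K * (t - t0)) ^ n / fact n)" by (rule bound[OF that])
      also have "\<dots> \<le> M n" unfolding M_def
        using that K by (intro mult_left_mono divide_right_mono power_mono) auto
      finally show ?thesis .
    qed
    have M: "summable M"
      unfolding M_def using summable_exp[of "K * (T - t0)"]
      by (intro summable_mult) (simp add: divide_inverse mult.commute)
    have ul: "uniform_limit {t0..T} (\<lambda>n x. \<Sum>i<n. w i x) y sequentially"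
      unfolding y_def[abs_def] by (rule Weierstrass_m_test[OF wM M])
    have ycont: "continuous_on {t0..T} y"
      by (rule uniform_limit_theorem[OF _ ul])
        (auto intro!: always_eventually continuous_on_sum continuous_on_subset[OF wcont])
    have summ: "summable (\<lambda>n. w n t)" if "t \<in> {t0..T}" for t
      by (rule summable_comparison_test'[OF M wM[OF that]])
    have Ay: "A s (y s) = (\<Sum>n. A s (w n s))" if "s \<in> {t0..T}" for s
      unfolding y_def by (rule bounded_linear.suminf[OF blinfun.bounded_linear_right summ[OF that]])
    \<comment> \<open>The termwise images under \<open>A\<close> have the majorant \<open>K * M n\<close>, which permits integrating their
      series term by term; the integrals telescope to the same iterates shifted by one.\<close>
    have ulA: "uniform_limit {t0..T} (\<lambda>n x. \<Sum>i<n. A x (w i x)) (\<lambda>s. \<Sum>n. A s (w n s)) sequentially"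
    proof (rule Weierstrass_m_test)
      fix n x assume x: "x \<in> {t0..T}"
      have "norm (A x (w n x)) \<le> norm (A x) * norm (w n x)" by (rule norm_blinfun)
      also have "\<dots> \<le> K * M n" using x by (intro mult_mono K wM) (use K in auto)
      finally show "norm (A x (w n x)) \<le> K * M n" .
    qed (intro summable_mult M)
    have "y t = y0 + integral {t0..t} (\<lambda>s. A s (y s))" if t: "t \<in> {t0..T}" for t
    proof -
      have sub: "{t0..t} \<subseteq> {t0..T}" using t by auto
      obtain I J where I: "\<And>n. ((\<lambda>x. \<Sum>i<n. A x (w i x)) has_integral I n) {t0..t}"
        and J: "((\<lambda>s. \<Sum>n. A s (w n s)) has_integral J) {t0..t}" and lim: "I \<longlonglongrightarrow> J"
        by (rule uniform_limit_integral[OF uniform_limit_on_subset[OF ulA sub], of thesis])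
          (auto intro!: continuous_on_sum continuous_on_subset[OF Awcont])
      have "I n = (\<Sum>i<n. w (Suc i) t)" for n
      proof -
        have "((\<lambda>x. \<Sum>i<n. A x (w i x)) has_integral (\<Sum>i<n. w (Suc i) t)) {t0..t}"
          unfolding wS
          by (intro has_integral_sum integrable_integral integrable_continuous_real
              continuous_on_subset[OF Awcont]) auto
        then show ?thesis using I has_integral_unique by blast
      qed
      then have "I = (\<lambda>n. \<Sum>i<n. w (Suc i) t)" by blast
      then have "(\<lambda>i. w (Suc i) t) sums J" using lim by (simp add: sums_def)
      then have "y t = J + w 0 t"
        unfolding y_def using sums_Suc[of "\<lambda>i. w i t"] by (simp add: sums_iff)
      moreover have "J = integral {t0..t} (\<lambda>s. A s (y s))"
        using J Ay sub by (metis (no_types, lifting) integral_cong integral_unique subsetD)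
      ultimately show ?thesis by (simp add: w0)
    qed
    with ycont show ?thesis by blast
  qed
  have ycont: "continuous_on {t0..} y"
    unfolding continuous_on_eq_continuous_within
  proof
    fix t assume t: "t \<in> {t0..}"
    show "continuous (at t within {t0..}) y"
      unfolding at_within_Ici_eq_Icc using key[of "t + 1"] t by (auto simp: continuous_on_eq_continuous_within)
  qed
  have Aycont: "continuous_on {t0..} (\<lambda>s. A s (y s))"
    using A ycont by (intro continuous_intros)
  show thesis
  proof (rule that)
    show "y t0 = y0" using key[of t0] by auto
    fix t assume t: "t0 \<le> t"
    have "((\<lambda>t. y0 + integral {t0..t} (\<lambda>s. A s (y s))) has_vector_derivative A t (y t)) (at t within {t0..})"
      using Ici_integral_has_vector_derivative[OF Aycont t]
      by (auto intro!: derivative_eq_intros)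
    then show "(y has_vector_derivative A t (y t)) (at t within {t0..})"
      by (rule has_vector_derivative_transform[rotated 2]) (use t key in \<open>auto\<close>)
  qed
qed

text \<open>The case of the first-order system on $\mathbb R^2$ with matrix $N + x(t)L$, where $N(u,w) = (w,0)$ and $L(u,w) = (0,u)$.\<close>

lemma second_order_solution_exists:
  fixes x :: "real \<Rightarrow> real"
  assumes x: "continuous_on {t0..} x"
  obtains u w where "u t0 = u0" "w t0 = w0"
    and "\<And>t. t0 \<le> t \<Longrightarrow> (u has_real_derivative w t) (at t within {t0..})"
    and "\<And>t. t0 \<le> t \<Longrightarrow> (w has_real_derivative x t * u t) (at t within {t0..})"
proof -
  let ?N = "\<lambda>y::real \<times> real. (snd y, 0::real)" and ?L = "\<lambda>y::real \<times> real. (0::real, fst y)"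
  have N: "blinfun_apply (Blinfun ?N) = ?N" and L: "blinfun_apply (Blinfun ?L) = ?L"
    by (intro bounded_linear_Blinfun_apply bounded_linear_intros)+
  have "continuous_on {t0..} (\<lambda>t. Blinfun ?N + x t *\<^sub>R Blinfun ?L)"
    by (intro continuous_intros x)
  then obtain y where y0: "y t0 = (u0, w0)" and y: "\<And>t. t0 \<le> t \<Longrightarrow>
      (y has_vector_derivative blinfun_apply (Blinfun ?N + x t *\<^sub>R Blinfun ?L) (y t))
        (at t within {t0..})"
    by (rule linear_ode_solution_exists[where ?y0.0 = "(u0, w0)"]) blast
  show thesis
  proof
    fix t assume "t0 \<le> t"
    from y[OF this] have *: "(y has_vector_derivative (snd (y t), x t * fst (y t))) (at t within {t0..})"
      by (simp add: blinfun.add_left blinfun.scaleR_left N L)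
    show "((\<lambda>t. fst (y t)) has_real_derivative snd (y t)) (at t within {t0..})"
      using bounded_linear.has_vector_derivative[OF bounded_linear_fst *]
      by (simp add: has_real_derivative_iff_has_vector_derivative)
    show "((\<lambda>t. snd (y t)) has_real_derivative x t * fst (y t)) (at t within {t0..})"
      using bounded_linear.has_vector_derivative[OF bounded_linear_snd *]
      by (simp add: has_real_derivative_iff_has_vector_derivative)
  qed (simp_all add: y0)
qed

section \<open>The growing solution of $u'' = a^2 u$\<close>

text \<open>The initial slope \<open>a t0\<close> makes the logarithmic derivative \<open>w / u\<close> start on its
  asymptotic value \<open>a\<close>, so that no initial error has to be carried along.\<close>

locale growing_solution =
  fixes t0 :: real and a a' u w :: "real \<Rightarrow> real"
  assumes a_pos: "\<And>t. t0 \<le> t \<Longrightarrow> 0 < a t"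
    and a_deriv: "\<And>t. t0 \<le> t \<Longrightarrow> (a has_real_derivative a' t) (at t within {t0..})"
    and u_deriv: "\<And>t. t0 \<le> t \<Longrightarrow> (u has_real_derivative w t) (at t within {t0..})"
    and w_deriv: "\<And>t. t0 \<le> t \<Longrightarrow> (w has_real_derivative (a t)\<^sup>2 * u t) (at t within {t0..})"
    and u_t0: "u t0 = 1" and w_t0: "w t0 = a t0"
begin

lemma continuous_a: "continuous_on {t0..} a" and continuous_u: "continuous_on {t0..} u"
  using DERIV_continuous_on a_deriv u_deriv by (metis atLeast_iff)+

text \<open>The derivative of $uu'$ is the sum of squares $u'^2 + a^2u^2$. Hence $uu'$ stays above its
  positive initial value, and in particular $u$ never vanishes.\<close>

lemma u_times_w_ge: assumes "t0 \<le> t" shows "a t0 \<le> u t * w t"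
proof -
  have "u t0 * w t0 \<le> u t * w t"
  proof (rule Ici_mono[OF _ assms])
    fix s assume "s \<in> {t0..t}"
    then show "((\<lambda>t. u t * w t) has_real_derivative (w s)\<^sup>2 + (a s)\<^sup>2 * (u s)\<^sup>2)
        (at s within {t0..})"
      by (auto intro!: derivative_eq_intros u_deriv w_deriv simp: power2_eq_square)
  qed auto
  then show ?thesis by (simp add: u_t0 w_t0)
qed

lemma u_pos: assumes "t0 \<le> t" shows "0 < u t"
proof (rule ccontr)
  assume "\<not> 0 < u t"
  then obtain s where "t0 \<le> s" "s \<le> t" "u s = 0"
    using IVT2'[of u t 0 t0] assms u_t0 continuous_on_subset[OF continuous_u] by fastforce
  with u_times_w_ge[of s] a_pos[of t0] show False by simp
qed

lemma w_pos: assumes "t0 \<le> t" shows "0 < w t"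
  using u_times_w_ge[OF assms] u_pos[OF assms] a_pos[of t0]
  by (smt (verit) mult_le_0_iff)

lemma w_ge: assumes "t0 \<le> t" shows "a t0 \<le> w t"
  unfolding w_t0[symmetric]
  by (rule Ici_mono[OF _ assms w_deriv]) (auto intro!: mult_nonneg_nonneg less_imp_le[OF u_pos])

lemma u_ge_1: assumes "t0 \<le> t" shows "1 \<le> u t"
  unfolding u_t0[symmetric]
  by (rule Ici_mono[OF _ assms u_deriv]) (auto intro: less_imp_le[OF w_pos])

text \<open>The tangent line $l(t) = 1 + a(t_0)(t - t_0)$ to \<open>u\<close> at \<open>t0\<close> produces the algebraic factor in
  \<open>R\<close>: the quotient $u/l$ is nondecreasing, because $u'l - a(t_0)u$ vanishes at \<open>t0\<close> and has
  derivative $u''l \ge 0$.\<close>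

lemma u_ratio_le:
  assumes "t0 \<le> s" "s \<le> t"
  shows "u s / u t \<le> (1 + a t0 * (s - t0)) / (1 + a t0 * (t - t0))"
proof -
  let ?l = "\<lambda>t. 1 + a t0 * (t - t0)"
  have l: "0 < ?l r" if "t0 \<le> r" for r
    using that a_pos[of t0] by (simp add: add_pos_nonneg)
  have *: "0 \<le> w r * ?l r - a t0 * u r" if "t0 \<le> r" for r
  proof -
    have "w t0 * ?l t0 - a t0 * u t0 \<le> w r * ?l r - a t0 * u r"
    proof (rule Ici_mono[OF _ that])
      fix v assume v: "v \<in> {t0..r}"
      show "((\<lambda>r. w r * ?l r - a t0 * u r) has_real_derivative (a v)\<^sup>2 * u v * ?l v)
          (at v within {t0..})"
        using v by (auto intro!: derivative_eq_intros u_deriv w_deriv)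
      show "0 \<le> (a v)\<^sup>2 * u v * ?l v"
        using v u_pos[of v] l[of v] by (auto intro!: mult_nonneg_nonneg)
    qed auto
    then show ?thesis by (simp add: u_t0 w_t0)
  qed
  have "u s / ?l s \<le> u t / ?l t"
  proof (rule Ici_mono[OF assms])
    fix v assume v: "v \<in> {s..t}"
    then have v': "t0 \<le> v" using assms by simp
    show "((\<lambda>r. u r / ?l r) has_real_derivative (w v * ?l v - a t0 * u v) / (?l v)\<^sup>2)
        (at v within {t0..})"
      using l[OF v'] v'
      by (auto intro!: derivative_eq_intros u_deriv simp: power2_eq_square)
    show "0 \<le> (w v * ?l v - a t0 * u v) / (?l v)\<^sup>2"
      using *[OF v'] by simp
  qed
  then show ?thesis
    using l[of s] l[of t] u_pos[of t] assms by (simp add: field_simps)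
qed

definition A :: "real \<Rightarrow> real" where "A t = integral {t0..t} a"

lemma A_deriv: "t0 \<le> t \<Longrightarrow> (A has_real_derivative a t) (at t within {t0..})"
  using Ici_integral_has_vector_derivative[OF continuous_a]
  by (simp add: A_def[abs_def] has_real_derivative_iff_has_vector_derivative)

lemma integral_a:
  assumes "t0 \<le> s" "s \<le> t" shows "integral {s..t} a = A t - A s"
  using Henstock_Kurzweil_Integration.integral_combine[of t0 s t a] assms
    integrable_continuous_real[OF continuous_on_subset[OF continuous_a]]
  by (auto simp: A_def)

text \<open>The difference of the logarithmic derivative from \<open>a\<close>; it solves the Riccati-type equation
  $z' = -a' - z\,(2a + z)$.\<close>

definition z :: "real \<Rightarrow> real" where "z t = w t / u t - a t"

lemma z_t0: "z t0 = 0" by (simp add: z_def u_t0 w_t0)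

text \<open>The comparison replaces the integrating factor of the equation for $z$: both
  $h = (u' - au)e^{\int a} = z\,u\,e^{\int a}$ and $k = S\,u\,e^{\int a}$ have explicit derivatives, with
  $|h'| = |a'|\,u\,e^{\int a} \le S\,a\,u\,e^{\int a} \le k'$ because $u' > 0$.\<close>

lemma z_propagation:
  assumes st: "t0 \<le> s" "s \<le> t" and S: "\<And>\<xi>. \<xi> \<in> {s..t} \<Longrightarrow> \<bar>a' \<xi>\<bar> / a \<xi> \<le> S"
  shows "\<bar>z t\<bar> \<le> \<bar>z s\<bar> * (u s / u t) * exp (- (A t - A s)) + S"
proof -
  have t: "t0 \<le> t" using st by simp
  have S0: "0 \<le> S"
    by (rule order_trans[OF _ S[of s]]) (use st a_pos[of s] in auto)
  let ?h = "\<lambda>t. (w t - a t * u t) * exp (A t)"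
  let ?k = "\<lambda>t. S * (u t * exp (A t))"
  have hz: "?h r = z r * (u r * exp (A r))" if "t0 \<le> r" for r
    using u_pos[OF that] by (simp add: z_def field_simps)
  have "norm (?h t - ?h s) \<le> ?k t - ?k s"
  proof (rule Ici_norm_diff_le[OF st])
    fix v assume v: "v \<in> {s..t}"
    then have v': "t0 \<le> v" using st by simp
    show "(?h has_vector_derivative - a' v * (u v * exp (A v))) (at v within {t0..})"
      unfolding has_real_derivative_iff_has_vector_derivative[symmetric]
      using v' by (auto intro!: derivative_eq_intros u_deriv w_deriv a_deriv A_deriv
          simp: algebra_simps power2_eq_square)
    show "(?k has_real_derivative S * ((w v + a v * u v) * exp (A v))) (at v within {t0..})"
      using v' by (auto intro!: derivative_eq_intros u_deriv A_deriv simp: algebra_simps)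
    have "\<bar>a' v\<bar> \<le> S * a v" using S[OF v] a_pos[OF v'] by (simp add: field_simps)
    then have "\<bar>a' v\<bar> * (u v * exp (A v)) \<le> S * a v * (u v * exp (A v))"
      using u_pos[OF v'] by (intro mult_right_mono) auto
    also have "\<dots> = S * (a v * u v * exp (A v))" by simp
    also have "\<dots> \<le> S * ((w v + a v * u v) * exp (A v))"
      using S0 w_pos[OF v'] by (intro mult_left_mono mult_right_mono) auto
    finally show "norm (- a' v * (u v * exp (A v))) \<le> S * ((w v + a v * u v) * exp (A v))"
      using u_pos[OF v'] by (simp add: abs_mult)
  qed
  moreover have "0 \<le> ?k s" using S0 u_pos[OF st(1)] by simp
  ultimately have "\<bar>?h t\<bar> \<le> \<bar>?h s\<bar> + ?k t" by simp
  then have "\<bar>z t\<bar> * (u t * exp (A t)) \<le> \<bar>z s\<bar> * (u s * exp (A s)) + S * (u t * exp (A t))"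
    using u_pos[OF t] u_pos[OF st(1)] by (simp add: hz t st abs_mult)
  then have "\<bar>z t\<bar> \<le> (\<bar>z s\<bar> * (u s * exp (A s)) + S * (u t * exp (A t))) / (u t * exp (A t))"
    using u_pos[OF t] by (simp add: field_simps)
  also have "\<dots> = \<bar>z s\<bar> * (u s / u t) * exp (- (A t - A s)) + S"
    using u_pos[OF t] by (simp add: exp_minus exp_diff field_simps)
  finally show ?thesis .
qed

lemma z_bound:
  assumes "t0 \<le> t" "\<And>\<xi>. \<xi> \<in> {t0..t} \<Longrightarrow> \<bar>a' \<xi>\<bar> / a \<xi> \<le> S"
  shows "\<bar>z t\<bar> \<le> S"
  using z_propagation[OF order_refl assms] by (simp add: z_t0)

text \<open>For each \<open>s\<close> the error at \<open>s\<close> is at most the first supremum in \<open>R\<close>, since it was built up from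
  $z(t_0) = 0$; from \<open>s\<close> to \<open>t\<close> it is damped by the first two factors of \<open>R\<close>, and the second supremum
  is what is added on the way.\<close>

lemma z_le_\<rho>:
  assumes x: "\<And>t. sqrt (x t) = a t"
    and M: "\<And>t. t0 \<le> t \<Longrightarrow> \<bar>a' t\<bar> / a t \<le> M"
    and t: "t0 \<le> t"
  shows "\<bar>z t\<bar> \<le> \<rho> t0 x t"
  unfolding \<rho>_def
proof (rule cINF_greatest)
  fix s assume s: "s \<in> {t0..t}"
  have L: "sqrt_logderiv t0 x \<xi> = \<bar>a' \<xi>\<bar> / a \<xi>" if "t0 \<le> \<xi>" for \<xi>
  proof -
    have "at \<xi> within {t0..} \<noteq> bot" by (rule at_within_Ici_neq_bot[OF that])
    then have "vector_derivative a (at \<xi> within {t0..}) = a' \<xi>"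
      using a_deriv[OF that] unfolding has_real_derivative_iff_has_vector_derivative
      by (rule vector_derivative_within)
    then show ?thesis by (simp add: sqrt_logderiv_def x)
  qed
  \<comment> \<open>The constant \<open>M\<close> makes the suprema genuine: without an upper bound a real-valued supremum
    carries no information.\<close>
  have sup: "\<bar>a' \<xi>\<bar> / a \<xi> \<le> (SUP \<xi>\<in>{b..c}. sqrt_logderiv t0 x \<xi>)"
    if "t0 \<le> b" "\<xi> \<in> {b..c}" for b c \<xi>
    unfolding L[symmetric, of \<xi>]
  proof -
    have "\<bar>a' \<xi>\<bar> / a \<xi> = sqrt_logderiv t0 x \<xi>" using L that by simp
    also have "\<dots> \<le> (SUP \<xi>\<in>{b..c}. sqrt_logderiv t0 x \<xi>)"
      using that L M by (intro cSUP_upper bdd_aboveI2[where M = M]) auto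
    finally show ?thesis .
  qed
  let ?S1 = "SUP \<xi>\<in>{t0..s}. sqrt_logderiv t0 x \<xi>"
  let ?S2 = "SUP \<xi>\<in>{s..t}. sqrt_logderiv t0 x \<xi>"
  have zs: "\<bar>z s\<bar> \<le> ?S1" using s by (intro z_bound sup) auto
  have "\<bar>z t\<bar> \<le> \<bar>z s\<bar> * (u s / u t) * exp (- (A t - A s)) + ?S2"
    using s by (intro z_propagation sup) auto
  also have "\<dots> \<le> ?S1 * ((1 + a t0 * (s - t0)) / (1 + a t0 * (t - t0))) * exp (- (A t - A s)) + ?S2"
    using s zs u_pos[of s] u_pos[of t] t
    by (intro add_right_mono mult_right_mono mult_mono u_ratio_le zs) auto
  also have "\<dots> = R t0 x s t"
    unfolding R_def x using integral_a[of s t] s by (simp add: mult.commute mult.left_commute)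
  finally show "\<bar>z t\<bar> \<le> R t0 x s t" .
qed (use t in auto)

text \<open>The logarithm of $(u' + au)\,a^{-1/2}e^{-\int a}$. As $u' + au$ is close to $2au$, this is up to a
  constant the quotient of $u$ by its WKB approximation $a^{-1/2}e^{\int a}$. Using $u' + au$ in place
  of $u$ makes the terms of first order in $z$ that carry no factor $a'$ cancel in the derivative.\<close>

definition H :: "real \<Rightarrow> real" where
  "H t = ln (w t + a t * u t) - A t - ln (a t) / 2"

definition H' :: "real \<Rightarrow> real" where
  "H' t = - a' t * z t / (2 * a t * (w t / u t + a t))"

lemma H_deriv:
  assumes t: "t0 \<le> t"
  shows "(H has_real_derivative H' t) (at t within {t0..})"
proof -
  have pos: "0 < u t" "0 < w t" "0 < a t" "0 < w t + a t * u t"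
    using u_pos[OF t] w_pos[OF t] a_pos[OF t] by (auto simp: add_pos_pos)
  have "(H has_real_derivative
     ((a t)\<^sup>2 * u t + (a' t * u t + a t * w t)) / (w t + a t * u t) - a t - a' t / (2 * a t))
      (at t within {t0..})"
    unfolding H_def[abs_def] using pos
    by (auto intro!: derivative_eq_intros u_deriv w_deriv a_deriv A_deriv t)
  also have "((a t)\<^sup>2 * u t + (a' t * u t + a t * w t)) / (w t + a t * u t) - a t - a' t / (2 * a t)
     = a' t * u t / (w t + a t * u t) - a' t / (2 * a t)"
    using pos by (simp add: divide_simps) (simp add: algebra_simps power2_eq_square)
  also have "w t + a t * u t = u t * (w t / u t + a t)"
    using pos by (simp add: algebra_simps)
  also have "a' t * u t / (u t * (w t / u t + a t)) - a' t / (2 * a t) = H' t"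
  proof -
    define y where "y = w t / u t"
    have y: "0 < y" "y + a t > 0" using pos by (auto simp: y_def add_pos_pos)
    show ?thesis unfolding H'_def z_def y_def[symmetric] using y pos
      by (simp add: divide_simps) (simp add: algebra_simps)
  qed
  finally show ?thesis .
qed

lemma H'_bound:
  assumes t: "t0 \<le> t"
  shows "\<bar>H' t\<bar> \<le> \<bar>a' t\<bar> * \<bar>z t\<bar> / (2 * (a t)\<^sup>2)"
proof -
  have pos: "0 < a t" "0 < w t / u t" using u_pos[OF t] w_pos[OF t] a_pos[OF t] by auto
  have "\<bar>H' t\<bar> = \<bar>a' t\<bar> * \<bar>z t\<bar> / (2 * a t * (w t / u t + a t))"
    using pos by (simp add: H'_def abs_mult)
  also have "\<dots> \<le> \<bar>a' t\<bar> * \<bar>z t\<bar> / (2 * (a t)\<^sup>2)"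
    using pos by (intro divide_left_mono) (auto simp: power2_eq_square intro!: mult_pos_pos)
  finally show ?thesis .
qed

lemma H_bounded_if_integrable:
  assumes f: "f integrable_on {t0..}"
    and le: "\<And>t. t0 \<le> t \<Longrightarrow> \<bar>a' t\<bar> * \<bar>z t\<bar> / (2 * (a t)\<^sup>2) \<le> f t"
    and t: "t0 \<le> t"
  shows "\<bar>H t - H t0\<bar> \<le> integral {t0..} f"
proof -
  have int: "(H' has_integral (H t - H t0)) {t0..t}"
  proof (rule fundamental_theorem_of_calculus[OF t])
    fix s assume "s \<in> {t0..t}"
    then have "(H has_vector_derivative H' s) (at s within {t0..})"
      using H_deriv[of s] by (simp add: has_real_derivative_iff_has_vector_derivative)
    then show "(H has_vector_derivative H' s) (at s within {t0..t})"
      by (rule has_vector_derivative_within_subset) auto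
  qed
  have fint: "f integrable_on {t0..t}"
    by (rule integrable_on_subinterval[OF f]) auto
  have "norm (integral {t0..t} H') \<le> integral {t0..t} f"
    using H'_bound le by (intro integral_norm_bound_integral fint)
      (use int in \<open>force intro: order_trans\<close>)+
  also have "\<dots> \<le> integral {t0..} f"
  proof (rule integral_subset_le[OF _ fint f])
    show "\<forall>s\<in>{t0..}. 0 \<le> f s"
    proof
      fix s assume "s \<in> {t0..}"
      have "0 \<le> \<bar>a' s\<bar> * \<bar>z s\<bar> / (2 * (a s)\<^sup>2)" by simp
      also have "\<dots> \<le> f s" using \<open>s \<in> {t0..}\<close> by (intro le) simp
      finally show "0 \<le> f s" .
    qed
  qed auto
  finally show ?thesis using int by (simp add: integral_unique)
qed

text \<open>Here $a'|z|/(2a^2) \le \frac M2\,a'/a^2$, which is the derivative of $-M/(2a)$.\<close>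

lemma H_bounded_if_mono:
  assumes nonneg: "\<And>t. t0 \<le> t \<Longrightarrow> 0 \<le> a' t"
    and M: "\<And>t. t0 \<le> t \<Longrightarrow> \<bar>z t\<bar> \<le> M"
    and t: "t0 \<le> t"
  shows "\<bar>H t - H t0\<bar> \<le> M / (2 * a t0)"
proof -
  have "norm (H t - H t0) \<le> - M / (2 * a t) - - M / (2 * a t0)"
  proof (rule Ici_norm_diff_le[OF _ t])
    fix v assume "v \<in> {t0..t}"
    then have v: "t0 \<le> v" by simp
    show "(H has_vector_derivative H' v) (at v within {t0..})"
      using H_deriv[OF v] by (simp add: has_real_derivative_iff_has_vector_derivative)
    show "((\<lambda>t. - M / (2 * a t)) has_real_derivative a' v * M / (2 * (a v)\<^sup>2)) (at v within {t0..})"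
      using a_pos[OF v] by (auto intro!: derivative_eq_intros a_deriv v simp: field_simps power2_eq_square)
    show "norm (H' v) \<le> a' v * M / (2 * (a v)\<^sup>2)"
      using order_trans[OF H'_bound[OF v] divide_right_mono[OF mult_left_mono[OF M[OF v]]]]
        nonneg[OF v] by simp
  qed simp
  also have "\<dots> \<le> M / (2 * a t0)"
    using a_pos[OF t] M[OF t] by simp
  finally show ?thesis by simp
qed

text \<open>The difference between \<open>H\<close> and the quantity in the conclusion is $\ln(2 + z/a)$, and
  $2 + z/a = 1 + u'/(au)$ lies between $1$ and $2 + M/\varepsilon$.\<close>

lemma log_u_asymptotics:
  assumes eps: "0 < \<epsilon>" "\<And>t. t0 \<le> t \<Longrightarrow> \<epsilon> \<le> a t"
    and M: "\<And>t. t0 \<le> t \<Longrightarrow> \<bar>z t\<bar> \<le> M"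
    and B: "\<And>t. t0 \<le> t \<Longrightarrow> \<bar>H t - H t0\<bar> \<le> B"
  obtains C where "\<And>t. t0 \<le> t \<Longrightarrow> \<bar>ln (u t) - A t + ln (a t) / 2\<bar> \<le> C"
proof
  fix t assume t: "t0 \<le> t"
  have pos: "0 < u t" "0 < w t" "0 < a t" "0 < w t + a t * u t"
    using u_pos[OF t] w_pos[OF t] a_pos[OF t] by (auto simp: add_pos_pos)
  have q: "w t + a t * u t = u t * a t * (2 + z t / a t)"
    using pos by (simp add: z_def field_simps)
  have "z t / a t > -1" using pos by (simp add: z_def field_simps)
  then have q1: "1 < 2 + z t / a t" by simp
  have "z t / a t \<le> M / \<epsilon>"
    using pos eps M[OF t] by (intro frac_le) (auto intro: eps(2) t)
  then have "ln (2 + z t / a t) \<le> ln (2 + M / \<epsilon>)" using q1 by simp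
  moreover have "0 \<le> ln (2 + z t / a t)" using q1 by simp
  moreover have "ln (w t + a t * u t) = ln (u t) + ln (a t) + ln (2 + z t / a t)"
    unfolding q using pos q1 by (simp add: ln_mult)
  ultimately show "\<bar>ln (u t) - A t + ln (a t) / 2\<bar> \<le> B + \<bar>H t0\<bar> + ln (2 + M / \<epsilon>)"
    using B[OF t] unfolding H_def[of t] by linarith
qed

text \<open>Reduction of order. With the constant Wronskian $c = uV - u'U$ one has $(U/u)' = c/u^2$ and
  $V - (u'/u)U = c/u$. The first is integrated with the bound
  $1/u^2 \le u'/(a(t_0)u^2)$, whose right-hand side is the derivative of $-1/(a(t_0)u)$; the second
  uses $u \ge 1$.\<close>

lemma solution_dominated:
  fixes U V :: "real \<Rightarrow> 'b::real_normed_vector"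
  assumes U: "\<And>t. t0 \<le> t \<Longrightarrow> (U has_vector_derivative V t) (at t within {t0..})"
    and V: "\<And>t. t0 \<le> t \<Longrightarrow> (V has_vector_derivative (a t)\<^sup>2 *\<^sub>R U t) (at t within {t0..})"
    and t: "t0 \<le> t"
  shows "norm (U t) \<le> u t * (norm (U t0) + norm (V t0 - a t0 *\<^sub>R U t0) / a t0)"
    and "norm (V t - (w t / u t) *\<^sub>R U t) \<le> norm (V t0 - a t0 *\<^sub>R U t0)"
proof -
  define c where "c = V t0 - a t0 *\<^sub>R U t0"
  have W: "u s *\<^sub>R V s - w s *\<^sub>R U s = c" if s: "t0 \<le> s" for s
  proof -
    have "u s *\<^sub>R V s - w s *\<^sub>R U s = u t0 *\<^sub>R V t0 - w t0 *\<^sub>R U t0"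
    proof (rule Ici_constant[OF s])
      fix r assume r: "t0 \<le> r"
      show "((\<lambda>s. u s *\<^sub>R V s - w s *\<^sub>R U s) has_vector_derivative 0) (at r within {t0..})"
        by (auto intro!: derivative_eq_intros u_deriv w_deriv U V r simp: algebra_simps)
    qed
    then show ?thesis by (simp add: c_def u_t0 w_t0)
  qed
  have diff: "V s - (w s / u s) *\<^sub>R U s = (1 / u s) *\<^sub>R c" if "t0 \<le> s" for s
    unfolding W[OF that, symmetric] using u_pos[OF that] by (simp add: algebra_simps)
  have "norm ((1 / u t) *\<^sub>R c) \<le> norm c"
    using u_ge_1[OF t] mult_left_mono[of 1 "u t" "norm c"] by (simp add: divide_le_eq)
  then show "norm (V t - (w t / u t) *\<^sub>R U t) \<le> norm (V t0 - a t0 *\<^sub>R U t0)"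
    unfolding diff[OF t] c_def .
  have a0: "0 < a t0" using a_pos by simp
  have "norm ((1 / u t) *\<^sub>R U t - (1 / u t0) *\<^sub>R U t0)
      \<le> - (norm c / a t0) / u t - - (norm c / a t0) / u t0"
  proof (rule Ici_norm_diff_le[OF _ t])
    fix s assume "s \<in> {t0..t}"
    then have s: "t0 \<le> s" by simp
    have us: "0 < u s" by (rule u_pos[OF s])
    have "((\<lambda>t. (1 / u t) *\<^sub>R U t) has_vector_derivative
        (1 / u s) *\<^sub>R V s + (- w s / (u s)\<^sup>2) *\<^sub>R U s) (at s within {t0..})"
      using us by (auto intro!: derivative_eq_intros u_deriv U s simp: power2_eq_square)
    also have "(1 / u s) *\<^sub>R V s + (- w s / (u s)\<^sup>2) *\<^sub>R U s = (1 / u s) *\<^sub>R (V s - (w s / u s) *\<^sub>R U s)"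
      by (simp add: algebra_simps power2_eq_square)
    also have "\<dots> = (1 / (u s)\<^sup>2) *\<^sub>R c"
      unfolding diff[OF s] by (simp add: power2_eq_square)
    finally show "((\<lambda>t. (1 / u t) *\<^sub>R U t) has_vector_derivative (1 / (u s)\<^sup>2) *\<^sub>R c)
        (at s within {t0..})" .
    show "((\<lambda>t. - (norm c / a t0) / u t) has_real_derivative (norm c / a t0) * w s / (u s)\<^sup>2)
        (at s within {t0..})"
      using us a0 by (auto intro!: derivative_eq_intros u_deriv s simp: power2_eq_square)
    have "norm c * 1 \<le> norm c * (w s / a t0)"
      using w_ge[OF s] a0 by (intro mult_left_mono) auto
    then have "norm c / (u s)\<^sup>2 \<le> norm c * (w s / a t0) / (u s)\<^sup>2"
      by (intro divide_right_mono) auto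
    then show "norm ((1 / (u s)\<^sup>2) *\<^sub>R c) \<le> (norm c / a t0) * w s / (u s)\<^sup>2" by simp
  qed simp
  also have "\<dots> \<le> norm c / a t0" using u_pos[OF t] a0 by (simp add: u_t0)
  finally have "norm ((1 / u t) *\<^sub>R U t) \<le> norm (U t0) + norm c / a t0"
    using norm_triangle_ineq2[of "(1 / u t) *\<^sub>R U t" "U t0"] by (simp add: u_t0)
  then show "norm (U t) \<le> u t * (norm (U t0) + norm (V t0 - a t0 *\<^sub>R U t0) / a t0)"
    using u_pos[OF t] by (simp add: c_def field_simps)
qed

end

section \<open>Stability read off from a growth exponent\<close>

text \<open>Lets the stability hypotheses, which speak of small initial values only, be applied to a given solution.\<close>

lemma solves_system_scaleR:
  assumes "solves_system t0 p q y"
  shows "solves_system t0 p q (\<lambda>t. s *\<^sub>R y t)"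
  unfolding solves_system_def
proof (intro allI impI)
  fix t assume "t0 \<le> t"
  with assms have "(y has_vector_derivative (snd (y t), - q t * fst (y t) - p t * snd (y t)))
      (at t within {t0..})"
    by (simp add: solves_system_def)
  from bounded_linear.has_vector_derivative[OF bounded_linear_scaleR_right[of s] this]
  show "((\<lambda>t. s *\<^sub>R y t) has_vector_derivative
      (snd (s *\<^sub>R y t), - q t * fst (s *\<^sub>R y t) - p t * snd (s *\<^sub>R y t))) (at t within {t0..})"
    by (simp add: scaleR_right_diff_distrib)
qed

text \<open>If $e^{r/2}$ bounds all solutions from above and one solution \<open>y1\<close> from below, up to constant
  factors, then it is the size of the fundamental matrix. Solutions that start small exist as
  multiples of \<open>y1\<close>. If $r$ tends to $-\infty$, it is bounded above on the whole half-line as well, because \<open>y1\<close>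
  tends to $0$ and is continuous, hence bounded.\<close>

lemma stability_iff_growth_exponent:
  assumes k: "0 < k" and c: "0 < c"
    and upper: "\<And>y t. solves_system t0 p q y \<Longrightarrow> t0 \<le> t \<Longrightarrow>
      norm (y t) \<le> k * exp (r t / 2) * norm (y t0)"
    and y1: "solves_system t0 p q y1"
    and lower: "\<And>t. t0 \<le> t \<Longrightarrow> exp (r t / 2) \<le> c * norm (y1 t)"
  shows "liapunov_stable t0 p q \<longleftrightarrow> bdd_above (r ` {t0..})"
    and "asymptotically_stable t0 p q \<longleftrightarrow> filterlim r at_bot at_top"
proof -
  have small: "\<exists>s>0. norm (s *\<^sub>R y1 t0) < \<delta>" if "0 < \<delta>" for \<delta>
  proof (intro exI conjI)
    have pos: "0 < norm (y1 t0) + 1" by (simp add: add_nonneg_pos)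
    then show "0 < \<delta> / (norm (y1 t0) + 1)" using that by simp
    have "\<delta> * norm (y1 t0) < \<delta> * (norm (y1 t0) + 1)" using that by simp
    then show "norm ((\<delta> / (norm (y1 t0) + 1)) *\<^sub>R y1 t0) < \<delta>"
      using pos that by (simp add: divide_less_eq)
  qed
  have bdd: "bdd_above (r ` {t0..})" if B: "\<And>t. t0 \<le> t \<Longrightarrow> norm (y1 t) \<le> B" for B
  proof (rule bdd_aboveI2)
    fix t assume "t \<in> {t0..}"
    then have t: "t0 \<le> t" by simp
    have le: "exp (r t / 2) \<le> c * B"
      using lower[OF t] mult_left_mono[OF B[OF t], of c] c by linarith
    moreover have "0 < c * B" using le exp_gt_zero[of "r t / 2"] by linarith
    ultimately have "r t / 2 \<le> ln (c * B)" by (subst ln_ge_iff)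
    then show "r t \<le> 2 * ln (c * B)" by simp
  qed
  show stab: "liapunov_stable t0 p q \<longleftrightarrow> bdd_above (r ` {t0..})"
  proof
    assume "liapunov_stable t0 p q"
    then obtain \<delta> where "\<delta> > 0" and \<delta>: "\<And>y t. solves_system t0 p q y \<Longrightarrow> norm (y t0) < \<delta> \<Longrightarrow>
        t0 \<le> t \<Longrightarrow> norm (y t) < 1"
      unfolding liapunov_stable_def by (meson zero_less_one)
    then obtain s where s: "0 < s" "norm (s *\<^sub>R y1 t0) < \<delta>" using small by blast
    have "norm (y1 t) \<le> 1 / s" if "t0 \<le> t" for t
      using \<delta>[OF solves_system_scaleR[OF y1] s(2) that] s(1) by (simp add: field_simps)
    then show "bdd_above (r ` {t0..})" by (rule bdd)
  next
    assume "bdd_above (r ` {t0..})"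
    then obtain B where B: "\<And>t. t0 \<le> t \<Longrightarrow> r t \<le> B" by (auto simp: bdd_above_def)
    let ?K = "k * exp (B / 2)"
    have K: "0 < ?K" using k by simp
    have "norm (y t) < \<epsilon>" if "\<epsilon> > 0" "solves_system t0 p q y" "norm (y t0) < \<epsilon> / ?K" "t0 \<le> t"
      for \<epsilon> y t
    proof -
      have "norm (y t) \<le> k * exp (r t / 2) * norm (y t0)" by (rule upper) fact+
      also have "\<dots> \<le> ?K * norm (y t0)"
        using k B[OF that(4)] by (intro mult_right_mono mult_left_mono) auto
      also have "\<dots> < \<epsilon>" using that(3) K by (simp add: field_simps)
      finally show ?thesis .
    qed
    then show "liapunov_stable t0 p q"
      unfolding liapunov_stable_def using K by (meson divide_pos_pos)
  qed
  show "asymptotically_stable t0 p q \<longleftrightarrow> filterlim r at_bot at_top"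
  proof
    assume "asymptotically_stable t0 p q"
    then obtain \<delta> where "\<delta> > 0" and \<delta>: "\<And>y. solves_system t0 p q y \<Longrightarrow> norm (y t0) < \<delta> \<Longrightarrow>
        (y \<longlongrightarrow> 0) at_top"
      unfolding asymptotically_stable_def by blast
    then obtain s where s: "0 < s" "norm (s *\<^sub>R y1 t0) < \<delta>" using small by blast
    have "((\<lambda>t. (c / s) * norm (s *\<^sub>R y1 t)) \<longlongrightarrow> (c / s) * 0) at_top"
      by (intro tendsto_intros tendsto_norm_zero \<delta> solves_system_scaleR y1 s)
    then have lim: "((\<lambda>t. c * norm (y1 t)) \<longlongrightarrow> 0) at_top" using s by simp
    show "filterlim r at_bot at_top"
      unfolding filterlim_at_bot
    proof
      fix Z :: real
      have "\<forall>\<^sub>F t in at_top. c * norm (y1 t) < exp (Z / 2)"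
        by (rule order_tendstoD(2)[OF lim]) simp
      then show "\<forall>\<^sub>F t in at_top. r t \<le> Z"
        using eventually_ge_at_top[of t0]
      proof eventually_elim
        case (elim t)
        then have "exp (r t / 2) < exp (Z / 2)" using lower[of t] by linarith
        then show ?case by simp
      qed
    qed
  next
    assume r: "filterlim r at_bot at_top"
    have "filterlim (\<lambda>t. (1/2) * r t) at_bot at_top"
      by (rule filterlim_tendsto_pos_mult_at_bot[OF tendsto_const _ r]) simp
    then have "((\<lambda>t. exp (r t / 2)) \<longlongrightarrow> 0) at_top"
      by (intro filterlim_compose[OF exp_at_bot]) simp
    then have "((\<lambda>t. k * exp (r t / 2) * norm (y t0)) \<longlongrightarrow> k * 0 * norm (y t0)) at_top"
      for y :: "real \<Rightarrow> complex \<times> complex"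
      by (intro tendsto_mult tendsto_const)
    then have lim: "((\<lambda>t. k * exp (r t / 2) * norm (y t0)) \<longlongrightarrow> 0) at_top"
      for y :: "real \<Rightarrow> complex \<times> complex"
      by simp
    have y0: "(y \<longlongrightarrow> 0) at_top" if y: "solves_system t0 p q y" for y
      by (rule Lim_null_comparison[OF _ lim[of y]])
        (use eventually_ge_at_top[of t0] in eventually_elim, rule upper[OF y])
    have "\<forall>\<^sub>F t in at_top. norm (y1 t) < 1"
      by (rule order_tendstoD(2)[OF tendsto_norm_zero[OF y0[OF y1]]]) simp
    then obtain N where N: "\<And>t. N \<le> t \<Longrightarrow> norm (y1 t) < 1"
      unfolding eventually_at_top_linorder by blast
    have "continuous_on {t0..N} y1"
      unfolding continuous_on_eq_continuous_within
    proof
      fix t assume "t \<in> {t0..N}"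
      then have "continuous (at t within {t0..}) y1"
        using y1 unfolding solves_system_def by (auto intro: has_vector_derivative_continuous)
      then show "continuous (at t within {t0..N}) y1"
        by (rule continuous_within_subset) auto
    qed
    then have "bounded (y1 ` {t0..N})"
      by (intro compact_imp_bounded compact_continuous_image) auto
    then obtain B where B: "\<forall>t\<in>{t0..N}. norm (y1 t) \<le> B"
      by (auto simp: bounded_iff)
    have "norm (y1 t) \<le> max B 1" if "t0 \<le> t" for t
      using B N[of t] that by (cases "t \<le> N") (auto simp: le_max_iff_disj less_imp_le)
    then have "liapunov_stable t0 p q" unfolding stab by (rule bdd)
    then show "asymptotically_stable t0 p q"
      unfolding asymptotically_stable_def using y0 zero_less_one by blast
  qed
qed

section \<open>Removing the damping term\<close>

context growing_solution
begin

text \<open>The number $m = |e^{-\frac12\int p}|\,u\,(1 + |p - 2a|)$ links both sides. By the asymptotics of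
  \<open>ln u\<close> it is comparable to $e^{r_2/2}$. For the solutions, $U = e^{\frac12\int p}\phi$ and
  $V = U' = e^{\frac12\int p}(\phi' + \frac p2\phi)$ satisfy the undamped equation, and
  $\phi' = e^{-\frac12\int p}\bigl((V - \tfrac{u'}u U) + (z - \tfrac12(p - 2a))\,U\bigr)$.
  As $z$ is bounded, the coefficient of $U$ has size $\frac12|p - 2a|$ up to a bounded
  error; this is the origin of the last logarithm in \<open>r2\<close>.\<close>

lemma stability_of_damped_equation:
  fixes p q p' :: "real \<Rightarrow> complex" and D :: "real \<Rightarrow> real"
  assumes p: "continuous_on {t0..} p"
    and p': "\<And>t. t0 \<le> t \<Longrightarrow> (p has_vector_derivative p' t) (at t within {t0..})"
    and D: "\<And>t. t0 \<le> t \<Longrightarrow> complex_of_real (D t) = 2 * p' t + (p t)\<^sup>2 - 4 * q t"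
    and Da: "\<And>t. t0 \<le> t \<Longrightarrow> D t = 4 * (a t)\<^sup>2"
    and M: "\<And>t. t0 \<le> t \<Longrightarrow> \<bar>z t\<bar> \<le> M"
    and C: "\<And>t. t0 \<le> t \<Longrightarrow> \<bar>ln (u t) - A t + ln (a t) / 2\<bar> \<le> C"
  shows "(liapunov_stable t0 p q \<longleftrightarrow> bdd_above (r2 t0 p D ` {t0..})) \<and>
         (asymptotically_stable t0 p q \<longleftrightarrow> filterlim (r2 t0 p D) at_bot at_top)"
proof -
  define P where "P t = integral {t0..t} p" for t
  have P0: "P t0 = 0" by (simp add: P_def)
  have P': "(P has_vector_derivative p t) (at t within {t0..})" if "t0 \<le> t" for t
    unfolding P_def[abs_def] by (rule Ici_integral_has_vector_derivative[OF p that])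
  have expP: "((\<lambda>t. exp (s * P t)) has_vector_derivative s * p t * exp (s * P t)) (at t within {t0..})"
    if "t0 \<le> t" for s t
  proof -
    have "((\<lambda>v. exp (s * v)) has_field_derivative s * exp (s * P t)) (at (P t) within P ` {t0..})"
      by (auto intro!: derivative_eq_intros)
    from field_vector_diff_chain_within[OF P'[OF that] this] show ?thesis
      by (simp add: o_def mult_ac)
  qed
  define m where "m t = exp (- Re (P t) / 2) * u t * (1 + cmod (p t - of_real (2 * a t)))" for t
  have m_pos: "0 < m t" if "t0 \<le> t" for t
    using u_pos[OF that] by (simp add: m_def add_pos_nonneg)
  have r2_m: "r2 t0 p D t / 2 = ln (m t) - (ln (u t) - A t + ln (a t) / 2) - ln 2 / 2"
    if t: "t0 \<le> t" for t
  proof -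
    have sq: "sqrt (D s) = 2 * a s" if "t0 \<le> s" for s
      using a_pos[OF that] by (simp add: Da[OF that] real_sqrt_mult)
    have pint: "p integrable_on {t0..t}" and aint: "a integrable_on {t0..t}"
      by (auto intro!: integrable_continuous_real continuous_on_subset[OF p]
          continuous_on_subset[OF continuous_a])
    have "integral {t0..t} (\<lambda>s. sqrt (D s) - Re (p s)) = integral {t0..t} (\<lambda>s. 2 * a s - Re (p s))"
      by (rule integral_cong) (simp add: sq)
    also have "\<dots> = integral {t0..t} (\<lambda>s. 2 * a s) - integral {t0..t} (\<lambda>s. Re (p s))"
      using integrable_linear[OF pint bounded_linear_Re] integrable_on_cmult_left[OF aint, of 2]
      by (intro integral_diff) (auto simp: o_def)
    also have "\<dots> = 2 * A t - Re (P t)"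
      using integral_linear[OF pint bounded_linear_Re] by (simp add: A_def P_def o_def)
    finally have int: "integral {t0..t} (\<lambda>s. sqrt (D s) - Re (p s)) = 2 * A t - Re (P t)" .
    have lnD: "ln (D t) = 2 * ln 2 + 2 * ln (a t)"
      using a_pos[OF t] ln_realpow[of 2 2] by (simp add: Da[OF t] ln_mult ln_realpow)
    have pos: "0 < 1 + cmod (p t - of_real (2 * a t))" by (simp add: add_pos_nonneg)
    have "ln (m t) = - Re (P t) / 2 + ln (u t) + ln (1 + cmod (p t - of_real (2 * a t)))"
      unfolding m_def using u_pos[OF t] pos by (simp add: ln_mult)
    then show ?thesis
      unfolding r2_def int lnD sq[OF t] by (simp add: field_simps)
  qed
  have m_le: "m t \<le> exp (C + ln 2 / 2) * exp (r2 t0 p D t / 2)" if t: "t0 \<le> t" for t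
  proof -
    have "ln (m t) \<le> (C + ln 2 / 2) + r2 t0 p D t / 2" using r2_m[OF t] C[OF t] by linarith
    then show ?thesis using m_pos[OF t] by (metis exp_add exp_le_cancel_iff exp_ln)
  qed
  have m_ge: "exp (r2 t0 p D t / 2) \<le> exp C * m t" if t: "t0 \<le> t" for t
  proof -
    have "0 \<le> ln (2::real)" by simp
    then have "r2 t0 p D t / 2 \<le> C + ln (m t)" using r2_m[OF t] C[OF t] by linarith
    then show ?thesis using m_pos[OF t] by (metis exp_add exp_le_cancel_iff exp_ln)
  qed
  have M0: "0 \<le> M" using M[of t0] by simp
  have a0: "0 < a t0" using a_pos by simp
  \<comment> \<open>\<open>c1\<close> bounds the Wronskian with \<open>u\<close>, and \<open>c2\<close> the quotient of \<open>U\<close> by \<open>u\<close>, both relative to the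
    initial norm.\<close>
  define c1 where "c1 = 1 + cmod (p t0) / 2 + a t0"
  define c2 where "c2 = 1 + c1 / a t0"
  have c: "0 < c1" "0 < c2" using a0 by (auto simp: c1_def c2_def add_pos_nonneg)
  have upper: "norm (y t) \<le> m t * (norm (y t0) * (c1 + (M + 2) * c2))"
    if y: "solves_system t0 p q y" and t: "t0 \<le> t" for y t
  proof -
    define \<phi> where "\<phi> t = fst (y t)" for t
    define \<psi> where "\<psi> t = snd (y t)" for t
    have y': "(y has_vector_derivative (\<psi> s, - q s * \<phi> s - p s * \<psi> s)) (at s within {t0..})"
      if "t0 \<le> s" for s
      using y that by (simp add: solves_system_def \<phi>_def \<psi>_def)
    have \<phi>': "(\<phi> has_vector_derivative \<psi> s) (at s within {t0..})" if "t0 \<le> s" for s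
      using bounded_linear.has_vector_derivative[OF bounded_linear_fst y'[OF that]]
      by (simp add: \<phi>_def[abs_def])
    have \<psi>': "(\<psi> has_vector_derivative - q s * \<phi> s - p s * \<psi> s) (at s within {t0..})"
      if "t0 \<le> s" for s
      using bounded_linear.has_vector_derivative[OF bounded_linear_snd y'[OF that]]
      by (simp add: \<psi>_def[abs_def])
    define U where "U t = exp (1/2 * P t) * \<phi> t" for t
    define V where "V t = exp (1/2 * P t) * (\<psi> t + p t / 2 * \<phi> t)" for t
    have U': "(U has_vector_derivative V s) (at s within {t0..})" if "t0 \<le> s" for s
      unfolding U_def[abs_def] V_def
      by (rule has_vector_derivative_eq_rhs[OF has_vector_derivative_mult[OF expP[OF that] \<phi>'[OF that]]])
        (simp add: algebra_simps)
    have V': "(V has_vector_derivative (a s)\<^sup>2 *\<^sub>R U s) (at s within {t0..})" if s: "t0 \<le> s" for s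
    proof -
      have q: "q s = (2 * p' s + (p s)\<^sup>2 - 4 * (of_real (a s))\<^sup>2) / 4"
        using D[OF s] by (simp add: Da[OF s] algebra_simps)
      have "((\<lambda>t. \<psi> t + p t / 2 * \<phi> t) has_vector_derivative
          (- q s * \<phi> s - p s * \<psi> s) + (p s / 2 * \<psi> s + p' s / 2 * \<phi> s)) (at s within {t0..})"
        by (intro has_vector_derivative_add has_vector_derivative_mult
            has_vector_derivative_divide \<phi>' \<psi>' p' s)
      from has_vector_derivative_mult[OF expP[OF s, of "1/2"] this]
      show ?thesis unfolding V_def[abs_def] U_def
        by (rule has_vector_derivative_eq_rhs)
          (simp add: q scaleR_conv_of_real power2_eq_square field_simps)
    qed
    let ?W = "norm (V t0 - a t0 *\<^sub>R U t0)"
    let ?K = "norm (U t0) + ?W / a t0"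
    let ?d = "cmod (p t - of_real (2 * a t))"
    let ?e = "exp (- Re (P t) / 2)"
    note dom = solution_dominated[OF U' V' t]
    have n0: "norm (\<phi> t0) \<le> norm (y t0)" "norm (\<psi> t0) \<le> norm (y t0)"
      unfolding \<phi>_def \<psi>_def by (metis norm_fst_le norm_snd_le prod.collapse)+
    have W: "?W \<le> norm (y t0) * c1"
    proof -
      have "?W = norm (\<psi> t0 + p t0 / 2 * \<phi> t0 - a t0 *\<^sub>R \<phi> t0)"
        by (simp add: U_def V_def P0)
      also have "\<dots> \<le> norm (\<psi> t0) + norm (p t0 / 2 * \<phi> t0) + norm (a t0 *\<^sub>R \<phi> t0)"
        by (meson norm_triangle_ineq norm_triangle_ineq4 order_trans add_right_mono)
      also have "\<dots> = norm (\<psi> t0) + cmod (p t0) / 2 * norm (\<phi> t0) + a t0 * norm (\<phi> t0)"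
        using a0 by (simp add: norm_mult norm_divide)
      also have "\<dots> \<le> norm (y t0) + cmod (p t0) / 2 * norm (y t0) + a t0 * norm (y t0)"
        using a0 n0 by (intro add_mono mult_left_mono) auto
      finally show ?thesis by (simp add: c1_def algebra_simps)
    qed
    have "?W / a t0 \<le> norm (y t0) * c1 / a t0" using W a0 by (intro divide_right_mono) auto
    then have K: "?K \<le> norm (y t0) * c2"
      using n0(1) by (simp add: U_def P0 c2_def algebra_simps)
    have K0: "0 \<le> ?K" "0 \<le> ?W" using a0 by simp_all
    \<comment> \<open>Both components are bounded by \<open>?e * u t\<close> times an expression in \<open>?d\<close>, \<open>?K\<close> and \<open>?W\<close>; the factor
      \<open>1 + ?d\<close> of \<open>m t\<close> absorbs every occurrence of \<open>?d\<close>, and \<open>u t \<ge> 1\<close> makes room for \<open>?W\<close>.\<close>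
    have "\<phi> t = exp (- (1/2 * P t)) * U t"
      by (simp add: U_def mult.assoc[symmetric] exp_add[symmetric])
    then have "norm (\<phi> t) = ?e * norm (U t)" by (simp add: norm_mult)
    also have "\<dots> \<le> ?e * (u t * ?K)" using dom(1) by (intro mult_left_mono) auto
    finally have \<phi>_le: "norm (\<phi> t) \<le> ?e * (u t * ?K)" .
    have "\<psi> t = exp (- (1/2 * P t)) * (V t - p t / 2 * U t)"
      by (simp add: U_def V_def algebra_simps) (simp add: mult.assoc[symmetric] exp_add[symmetric])
    also have "V t - p t / 2 * U t =
        (V t - (w t / u t) *\<^sub>R U t) + (of_real (z t) - (p t - of_real (2 * a t)) / 2) * U t"
      by (simp add: z_def scaleR_conv_of_real algebra_simps) (simp add: field_simps)
    finally have "norm (\<psi> t) = ?e *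
        norm ((V t - (w t / u t) *\<^sub>R U t) + (of_real (z t) - (p t - of_real (2 * a t)) / 2) * U t)"
      by (simp add: norm_mult)
    also have "\<dots> \<le> ?e * (?W + (M + ?d / 2) * (u t * ?K))"
    proof (intro mult_left_mono norm_triangle_le add_mono dom(2))
      have "cmod (of_real (z t) - (p t - of_real (2 * a t)) / 2) \<le> \<bar>z t\<bar> + ?d / 2"
        by (rule order_trans[OF norm_triangle_ineq4]) (simp add: norm_divide)
      then have "cmod (of_real (z t) - (p t - of_real (2 * a t)) / 2) \<le> M + ?d / 2"
        using M[OF t] by linarith
      then show "norm ((of_real (z t) - (p t - of_real (2 * a t)) / 2) * U t) \<le> (M + ?d / 2) * (u t * ?K)"
        unfolding norm_mult using M0 by (intro mult_mono dom(1)) auto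
    qed auto
    finally have \<psi>_le: "norm (\<psi> t) \<le> ?e * (?W + (M + ?d / 2) * (u t * ?K))" .
    have "?W \<le> u t * ?W" using u_ge_1[OF t] K0(2) mult_right_mono[of 1 "u t" ?W] by simp
    then have "u t * ?K + (?W + (M + ?d / 2) * (u t * ?K))
        \<le> u t * (?K + ?W + (M + ?d / 2) * ?K)" by (simp add: algebra_simps)
    also have "\<dots> \<le> u t * ((1 + ?d) * (?W + (M + 2) * ?K))"
    proof (intro mult_left_mono)
      have "0 \<le> ?d * ?W" "0 \<le> ?d * (M * ?K)" "0 \<le> ?d * ?K"
        using K0 M0 by (auto intro!: mult_nonneg_nonneg)
      then show "?K + ?W + (M + ?d / 2) * ?K \<le> (1 + ?d) * (?W + (M + 2) * ?K)"
        using K0 unfolding ring_distribs by (simp only: mult_1 mult_1_right mult.assoc)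
    qed (use u_pos[OF t] in simp)
    finally have "?e * (u t * ?K) + ?e * (?W + (M + ?d / 2) * (u t * ?K))
        \<le> ?e * (u t * ((1 + ?d) * (?W + (M + 2) * ?K)))"
      unfolding distrib_left[of ?e, symmetric] by (intro mult_left_mono) auto
    also have "\<dots> = m t * (?W + (M + 2) * ?K)" by (simp add: m_def mult.assoc)
    also have "\<dots> \<le> m t * (norm (y t0) * c1 + (M + 2) * (norm (y t0) * c2))"
      using m_pos[OF t] M0 W K by (intro mult_left_mono add_mono) auto
    finally have "norm (\<phi> t) + norm (\<psi> t) \<le> m t * (norm (y t0) * (c1 + (M + 2) * c2))"
      using \<phi>_le \<psi>_le by (simp add: algebra_simps)
    moreover have "norm (y t) \<le> norm (\<phi> t) + norm (\<psi> t)"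
      using norm_Pair_le[of "\<phi> t" "\<psi> t"] by (simp add: \<phi>_def \<psi>_def)
    ultimately show ?thesis by linarith
  qed
  \<comment> \<open>The lower bound comes from the solution that corresponds to \<open>u\<close> itself.\<close>
  define E where "E t = exp (- 1/2 * P t)" for t
  define y1 where "y1 t = (E t * of_real (u t), E t * (of_real (w t) - p t / 2 * of_real (u t)))" for t
  have E': "(E has_vector_derivative - 1/2 * p t * E t) (at t within {t0..})" if "t0 \<le> t" for t
    unfolding E_def[abs_def] by (rule expP[OF that])
  have y1: "solves_system t0 p q y1"
    unfolding solves_system_def
  proof (intro allI impI)
    fix t assume t: "t0 \<le> t"
    have q: "q t = (2 * p' t + (p t)\<^sup>2 - 4 * (of_real (a t))\<^sup>2) / 4"
      using D[OF t] by (simp add: Da[OF t] algebra_simps)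
    have u': "((\<lambda>t. complex_of_real (u t)) has_vector_derivative of_real (w t)) (at t within {t0..})"
      and w': "((\<lambda>t. complex_of_real (w t)) has_vector_derivative of_real ((a t)\<^sup>2 * u t)) (at t within {t0..})"
      using has_vector_derivative_of_real[OF u_deriv[OF t]]
        has_vector_derivative_of_real[OF w_deriv[OF t]] by blast+
    have "(y1 has_vector_derivative
        (E t * of_real (w t) + - 1/2 * p t * E t * of_real (u t),
         E t * (of_real ((a t)\<^sup>2 * u t) - (p t / 2 * of_real (w t) + p' t / 2 * of_real (u t)))
         + - 1/2 * p t * E t * (of_real (w t) - p t / 2 * of_real (u t)))) (at t within {t0..})"
      unfolding y1_def[abs_def]
      by (intro has_vector_derivative_Pair has_vector_derivative_mult has_vector_derivative_diff
          has_vector_derivative_divide E' u' w' p' t)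
    then show "(y1 has_vector_derivative
        (snd (y1 t), - q t * fst (y1 t) - p t * snd (y1 t))) (at t within {t0..})"
      by (rule has_vector_derivative_eq_rhs) (simp add: y1_def q field_simps power2_eq_square)
  qed
  have lower: "m t \<le> (3 + 2 * M) * norm (y1 t)" if t: "t0 \<le> t" for t
  proof -
    let ?d = "cmod (p t - of_real (2 * a t))"
    let ?e = "exp (- Re (P t) / 2)"
    have nE: "norm (E t) = ?e" by (simp add: E_def)
    have ut: "0 < u t" by (rule u_pos[OF t])
    have 1: "?e * u t \<le> norm (y1 t)"
      using norm_fst_le[of "fst (y1 t)" "snd (y1 t)"] ut by (simp add: y1_def norm_mult nE)
    let ?g = "cmod (of_real (w t / u t) - p t / 2)"
    have "snd (y1 t) = E t * of_real (u t) * (of_real (w t / u t) - p t / 2)"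
      using ut by (simp add: y1_def algebra_simps)
    then have "norm (snd (y1 t)) = ?e * u t * ?g" using ut by (simp only: norm_mult nE) simp
    then have 2: "?e * u t * ?g \<le> norm (y1 t)" using norm_snd_le[of "snd (y1 t)" "fst (y1 t)"] by simp
    \<comment> \<open>Where \<open>?d\<close> is large, \<open>snd (y1 t)\<close> must be large, as \<open>z\<close> is bounded.\<close>
    have "(p t - of_real (2 * a t)) / 2 = of_real (z t) - (of_real (w t / u t) - p t / 2)"
      by (simp add: z_def field_simps)
    then have "cmod ((p t - of_real (2 * a t)) / 2) \<le> \<bar>z t\<bar> + ?g"
      by (metis norm_of_real norm_triangle_ineq4)
    then have "?d \<le> 2 * M + 2 * ?g" using M[OF t] by (simp add: norm_divide)
    then have "?e * u t * (1 + ?d) \<le> ?e * u t * (1 + (2 * M + 2 * ?g))"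
      using ut by (intro mult_left_mono) auto
    also have "\<dots> = (1 + 2 * M) * (?e * u t) + 2 * (?e * u t * ?g)" by (simp add: algebra_simps)
    also have "\<dots> \<le> (1 + 2 * M) * norm (y1 t) + 2 * norm (y1 t)"
      using 1 2 M0 by (intro add_mono mult_left_mono) auto
    finally show ?thesis by (simp add: m_def algebra_simps)
  qed
  let ?k = "exp (C + ln 2 / 2) * (c1 + (M + 2) * c2)" and ?c = "exp C * (3 + 2 * M)"
  have k: "0 < ?k" "0 < ?c" using c M0 by (auto intro!: mult_pos_pos add_pos_nonneg)
  have up: "norm (y t) \<le> ?k * exp (r2 t0 p D t / 2) * norm (y t0)"
    if "solves_system t0 p q y" "t0 \<le> t" for y t
  proof -
    have "norm (y t) \<le> m t * (norm (y t0) * (c1 + (M + 2) * c2))" by (rule upper[OF that])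
    also have "\<dots> \<le> exp (C + ln 2 / 2) * exp (r2 t0 p D t / 2) * (norm (y t0) * (c1 + (M + 2) * c2))"
      using c M0 by (intro mult_right_mono m_le that) auto
    finally show ?thesis by (simp add: mult_ac)
  qed
  have low: "exp (r2 t0 p D t / 2) \<le> ?c * norm (y1 t)" if t: "t0 \<le> t" for t
  proof -
    have "exp C * m t \<le> exp C * ((3 + 2 * M) * norm (y1 t))"
      by (intro mult_left_mono lower t) simp
    with m_ge[OF t] show ?thesis unfolding mult.assoc by (rule order_trans)
  qed
  show ?thesis
    by (intro conjI; rule stability_iff_growth_exponent[OF k up y1 low])
qed

end

section \<open>The stability criterion\<close>

theorem theorem2p2:
  fixes t0 :: real
    and p q p' :: "real \<Rightarrow> complex"
    and D D' :: "real \<Rightarrow> real"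
  assumes "continuous_on {t0..} p"
    and "continuous_on {t0..} q"
    and "\<And>t. t \<ge> t0 \<Longrightarrow> (p has_vector_derivative p' t) (at t within {t0..})"
    and "continuous_on {t0..} p'"
    and "\<And>t. t \<ge> t0 \<Longrightarrow> complex_of_real (D t) = 2 * p' t + (p t)\<^sup>2 - 4 * q t"
    and "\<And>t. t \<ge> t0 \<Longrightarrow> D t > 0"
    and "\<And>t. t \<ge> t0 \<Longrightarrow> (D has_real_derivative D' t) (at t within {t0..})"
    and "continuous_on {t0..} D'"
    and "condition_C t0 D D' \<or> condition_D t0 D D'"
  shows "(liapunov_stable t0 p q \<longleftrightarrow> bdd_above (r2 t0 p D ` {t0..})) \<and>
         (asymptotically_stable t0 p q \<longleftrightarrow> filterlim (r2 t0 p D) at_bot at_top)"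
proof -
  note D_pos = assms(6) and D_deriv = assms(7)
  \<comment> \<open>\<open>a\<close> is literally the square root of \<open>D / 4\<close>, the form in which it occurs inside \<open>\<rho>\<close>.\<close>
  define x where "x t = D t / 4" for t
  define a where "a t = sqrt (x t)" for t
  define a' where "a' t = D' t / (8 * a t)" for t
  have a_pos: "0 < a t" and a_sq: "(a t)\<^sup>2 = x t" if "t0 \<le> t" for t
    using D_pos[OF that] by (simp_all add: a_def x_def)
  have a_deriv: "(a has_real_derivative a' t) (at t within {t0..})" if t: "t0 \<le> t" for t
    unfolding a_def[abs_def] x_def a'_def using D_pos[OF t]
    by (auto intro!: derivative_eq_intros D_deriv t simp: field_simps)
  have "continuous_on {t0..} x"
    unfolding x_def[abs_def] using DERIV_continuous_on[of "{t0..}" D D'] D_deriv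
    by (auto intro!: continuous_intros)
  then obtain u w where "u t0 = 1" "w t0 = a t0"
    and "\<And>t. t0 \<le> t \<Longrightarrow> (u has_real_derivative w t) (at t within {t0..})"
    and "\<And>t. t0 \<le> t \<Longrightarrow> (w has_real_derivative x t * u t) (at t within {t0..})"
    using second_order_solution_exists[of t0 x 1 "a t0"] by metis
  then interpret growing_solution t0 a a' u w
    by unfold_locales (auto simp: a_pos a_sq a_deriv)
  have "bounded ((\<lambda>t. D' t / D t) ` {t0..})"
    using assms(9) by (auto simp: condition_C_def condition_D_def)
  then obtain K where K: "\<And>t. t0 \<le> t \<Longrightarrow> \<bar>D' t / D t\<bar> \<le> K"
    by (auto simp: bounded_iff)
  have ratio: "\<bar>a' t\<bar> / a t \<le> K / 2" if t: "t0 \<le> t" for t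
  proof -
    have "\<bar>a' t\<bar> / a t = \<bar>D' t\<bar> / (8 * (a t)\<^sup>2)"
      using a_pos[OF t] by (simp add: a'_def power2_eq_square)
    also have "\<dots> = \<bar>D' t / D t\<bar> / 2" using D_pos[OF t] by (simp add: a_sq[OF t] x_def)
    finally show ?thesis using K[OF t] by simp
  qed
  have z: "\<bar>z t\<bar> \<le> K / 2" if "t0 \<le> t" for t
    by (rule z_bound[OF that ratio]) simp
  have "\<exists>\<epsilon>>0. \<forall>t\<ge>t0. \<epsilon> \<le> a t"
    using assms(9)
  proof
    assume "condition_C t0 D D'"
    then obtain \<epsilon> where "\<epsilon> > 0" "\<And>t. t0 \<le> t \<Longrightarrow> \<epsilon> \<le> D t" by (auto simp: condition_C_def)
    then show ?thesis by (intro exI[of _ "sqrt (\<epsilon> / 4)"]) (auto simp: a_def x_def)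
  next
    assume "condition_D t0 D D'"
    then have "D t0 \<le> D t" if "t0 \<le> t" for t
      using that by (auto simp: condition_D_def mono_on_def)
    then show ?thesis using a_pos[of t0] by (intro exI[of _ "a t0"]) (auto simp: a_def x_def)
  qed
  then obtain \<epsilon> where \<epsilon>: "0 < \<epsilon>" "\<And>t. t0 \<le> t \<Longrightarrow> \<epsilon> \<le> a t" by blast
  have "\<exists>B. \<forall>t\<ge>t0. \<bar>H t - H t0\<bar> \<le> B"
    using assms(9)
  proof
    assume *: "condition_C t0 D D'"
    let ?g = "\<lambda>s. \<rho> t0 (\<lambda>t. D t / 4) s * (\<bar>D' s\<bar> / D s powr (3/2))"
    have "(\<lambda>s. ?g s / 2) integrable_on {t0..}"
      by (rule integrable_on_divide) (use * in \<open>simp add: condition_C_def\<close>)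
    moreover have "\<bar>a' t\<bar> * \<bar>z t\<bar> / (2 * (a t)\<^sup>2) \<le> ?g t / 2" if t: "t0 \<le> t" for t
    proof -
      have "\<bar>z t\<bar> \<le> \<rho> t0 (\<lambda>t. D t / 4) t"
        by (rule z_le_\<rho>[OF _ ratio t]) (simp add: a_def x_def)
      \<comment> \<open>Since \<open>D t = (2 * a t)\<^sup>2\<close> and \<open>a' t = D' t / (8 * a t)\<close>, the weight in (C) is a multiple of
        \<open>\<bar>a' t\<bar> / (a t)\<^sup>2\<close>.\<close>
      moreover have "D t powr (3/2) = 8 * (a t) ^ 3"
      proof -
        have "D t = (2 * a t) powr 2"
          using a_pos[OF t] a_sq[OF t] by (simp add: powr_numeral x_def power_mult_distrib)
        then have "D t powr (3/2) = (2 * a t) powr (2 * (3/2))" by (simp only: powr_powr)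
        also have "\<dots> = (2 * a t) ^ 3" using a_pos[OF t] by (simp add: powr_numeral)
        finally show ?thesis by (simp add: power_mult_distrib)
      qed
      then have "\<bar>a' t\<bar> * \<bar>z t\<bar> / (2 * (a t)\<^sup>2) = \<bar>z t\<bar> * (\<bar>D' t\<bar> / D t powr (3/2)) / 2"
        using a_pos[OF t] by (simp add: a'_def power2_eq_square power3_eq_cube)
      ultimately show ?thesis
        by (simp add: divide_right_mono mult_right_mono)
    qed
    ultimately show ?thesis using H_bounded_if_integrable by blast
  next
    assume "condition_D t0 D D'"
    then have "0 \<le> D' t" if "t0 \<le> t" for t
      using Ici_deriv_nonneg[OF _ D_deriv that] that by (simp add: condition_D_def)
    then have "0 \<le> a' t" if "t0 \<le> t" for t using a_pos that by (simp add: a'_def less_imp_le)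
    then show ?thesis using H_bounded_if_mono[of "K / 2"] z by blast
  qed
  then obtain B where "\<And>t. t0 \<le> t \<Longrightarrow> \<bar>H t - H t0\<bar> \<le> B" by blast
  from log_u_asymptotics[OF \<epsilon> z this] obtain C
    where C: "\<And>t. t0 \<le> t \<Longrightarrow> \<bar>ln (u t) - A t + ln (a t) / 2\<bar> \<le> C" by blast
  have Da: "D t = 4 * (a t)\<^sup>2" if "t0 \<le> t" for t
    by (simp add: a_sq[OF that] x_def)
  show ?thesis
    by (rule stability_of_damped_equation[OF assms(1,3,5) Da z C])
qed

end
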